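(* Consider the two-stage stochastic linear program $(P)$: $\min_{x\in\mathcal X}\{c^\top x+q(x)\}$, with optimal value $z^*$ and optimal solution set $\mathcal S^*$, and let $(\hat x^\ell)_{\ell\ge1}$ be the iterates generated by the adaptive sequential SAA algorithm described in the context. Suppose the following. (1) $\mathcal X$ is compact and $(P)$ has relatively complete recourse: $\mathbb P\{\{y\in\mathbb R^{n_2}_+: W(\xi)y\ge h(\xi)-T(\xi)x\}=\emptyset\}=0$ for all $x\in\mathcal X$. (2) For all $\ell\ge1$, $\sup_{x\in\mathcal X}\mathrm{Var}(Q(x,\xi^\ell)\mid\mathcal F_{\ell-1})<\infty$ a.s., and there is a constant $\kappa_0<\infty$ such that for all $\ell\ge1$ (and all sample sizes $m$), $\mathbb E\big[\sup_{x\in\mathcal X}|Q^\ell_m(x)-q(x)|^2\mid\mathcal F_{\ell-1}\big]\le\kappa_0/m$ a.s. (3) The sample sizes satisfy $m_\ell\ge1$ and $\sum_{\ell=1}^\infty m_\ell^{-1/2}<\infty$. Then: (a) $c^\top\hat x^\ell+q(\hat x^\ell)\to z^*$ a.s. as $\ell\to\infty$; (b) $\mathbb E[c^\top\hat x^\ell+q(\hat x^\ell)]\to z^*$ as $\ell\to\infty$. If in addition the true objective has first-order growth on $\mathcal X$, i.e. $\gamma_0:=\sup\{s: c^\top x+q(x)-z^*\ge s\,\mathrm{dist}(x,\mathcal S^* )\ \ \forall x\in\mathcal X\}>0$, then also: (c) $\mathrm{dist}(\hat x^\ell,\mathcal S^* )\to0$ a.s. as $\ell\to\infty$; (d) $\mathbb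 E[\mathrm{dist}(\hat x^\ell,\mathcal S^* )]\to0$ as $\ell\to\infty$.
   Context: Two-stage stochastic linear program: $\mathcal X=\{x\in\mathbb R^{n_1}_+: Ax=b\}$ with $A,b,c$ fixed; $\xi$ is a random element of $\Xi$ with law $P$; $Q(x,\xi)=\min_{y\in\mathbb R^{n_2}_+}\{d(\xi)^\top y: W(\xi)y\ge h(\xi)-T(\xi)x\}$, assumed $>-\infty$ for all $x\in\mathcal X$, $\xi\in\Xi$; $q(x)=\mathbb E[Q(x,\xi)]$. Sampling: there is a filtered probability space $(\Omega,\mathcal F,(\mathcal F_\ell)_{\ell\ge1},\mathbb P)$. In (outer) iteration $\ell$ one generates identically distributed (not necessarily independent), $\mathcal F_\ell$-measurable scenarios $\xi^\ell_1,\xi^\ell_2,\dots$ ($\xi^\ell$ is a generic one) and sets $Q^\ell_m(x)=m^{-1}\sum_{j=1}^mQ(x,\xi^\ell_j)$. The deterministic sample size used in iteration $\ell$ is $m_\ell$. The sample-path problem $(P_\ell)$ is $\min_{x\in\mathcal X}\{c^\top x+Q^\ell_{m_\ell}(x)\}$, with optimal value $z^*_{m_\ell}$. Algorithm: fix constants $\nu>0$ and $0<\sigma_{\min}<\sigma_{\max}<\infty$. In outer iteration $\ell$, an iterative solver applied to $(P_\ell)$ (started from $\hat x^{\ell-1}$) produces points $\hat x^{\ell,t}\in\mathcal X$, $t=1,2,\dots$, together with upper bounds $G^{\ell,t}\ge c^\top\hat x^{\ell,t}+Q^\ell_{m_\ell}(\hat x^{\ell,t})-z^*_{m_\ell}$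 on their optimality gaps for $(P_\ell)$, and it stops at the first $t$ with $G^{\ell,t}\le\epsilon_{\ell,t}:=\nu\,m_\ell^{-1/2}\,\mathrm{proj}(\hat\sigma_{\ell,t},[\sigma_{\min},\sigma_{\max}])$, where $\hat\sigma_{\ell,t}^2=m_\ell^{-1}\sum_{i=1}^{m_\ell}[Q(\hat x^{\ell,t},\xi^\ell_i)-Q^\ell_{m_\ell}(\hat x^{\ell,t})]^2$ and $\mathrm{proj}(\cdot,[a,b])$ is projection onto $[a,b]$. The output is $\hat x^\ell:=\hat x^{\ell,t}$, which is $\mathcal F_\ell$-measurable, and $\epsilon_\ell:=\epsilon_{\ell,t}$ for this $t$; thus $\hat x^\ell\in\mathcal X$ is $\epsilon_\ell$-optimal for $(P_\ell)$. $\mathrm{dist}(x,S)=\inf\{\|x-z\|_2:z\in S\}$. *)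

theory Defs
  imports "HOL-Probability.Probability"
begin

(* Vectors are ordered componentwise (the library order on "real ^ 'n"). *)

definition first_stage_set :: "real^'n1^'k \<Rightarrow> real^'k \<Rightarrow> (real^'n1) set" where
  "first_stage_set A b = {x. 0 \<le> x \<and> A *v x = b}"

definition recourse_set ::
  "('xi \<Rightarrow> real^'n2^'r) \<Rightarrow> ('xi \<Rightarrow> real^'r) \<Rightarrow> ('xi \<Rightarrow> real^'n1^'r)
    \<Rightarrow> real^'n1 \<Rightarrow> 'xi \<Rightarrow> (real^'n2) set" where
  "recourse_set W h T x \<xi> = {y. 0 \<le> y \<and> h \<xi> - T \<xi> *v x \<le> W \<xi> *v y}"

(* Extended-valued: +\<infinity> when the second stage is infeasible, -\<infinity> when it is unbounded. *)
definition recourse_value ::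
  "('xi \<Rightarrow> real^'n2) \<Rightarrow> ('xi \<Rightarrow> real^'n2^'r) \<Rightarrow> ('xi \<Rightarrow> real^'r) \<Rightarrow> ('xi \<Rightarrow> real^'n1^'r)
    \<Rightarrow> real^'n1 \<Rightarrow> 'xi \<Rightarrow> ereal" where
  "recourse_value d W h T x \<xi> = (INF y\<in>recourse_set W h T x \<xi>. ereal (d \<xi> \<bullet> y))"

(* Under relatively complete recourse Q x is finite almost surely for each feasible x,
   so that passing to the real value changes the integrand only on a null set. *)
definition expected_recourse :: "'xi measure \<Rightarrow> ('x \<Rightarrow> 'xi \<Rightarrow> ereal) \<Rightarrow> 'x \<Rightarrow> real" where
  "expected_recourse P Q x = (\<integral>\<xi>. real_of_ereal (Q x \<xi>) \<partial>P)"

definition sample_mean :: "('x \<Rightarrow> 'xi \<Rightarrow> ereal) \<Rightarrow> (nat \<Rightarrow> 'xi) \<Rightarrow> nat \<Rightarrow> 'x \<Rightarrow> ereal" where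
  "sample_mean Q \<xi>s m x = (\<Sum>j=1..m. Q x (\<xi>s j)) / ereal (real m)"

definition sample_sd :: "('x \<Rightarrow> 'xi \<Rightarrow> ereal) \<Rightarrow> (nat \<Rightarrow> 'xi) \<Rightarrow> nat \<Rightarrow> 'x \<Rightarrow> real" where
  "sample_sd Q \<xi>s m x =
     sqrt ((\<Sum>i=1..m. (real_of_ereal (Q x (\<xi>s i)) - real_of_ereal (sample_mean Q \<xi>s m x))\<^sup>2)
            / real m)"

definition saa_value ::
  "real^'n \<Rightarrow> (real^'n) set \<Rightarrow> (real^'n \<Rightarrow> 'xi \<Rightarrow> ereal) \<Rightarrow> (nat \<Rightarrow> 'xi) \<Rightarrow> nat \<Rightarrow> ereal" where
  "saa_value c X Q \<xi>s m = (INF x\<in>X. ereal (c \<bullet> x) + sample_mean Q \<xi>s m x)"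

definition error_tolerance ::
  "real \<Rightarrow> real \<Rightarrow> real \<Rightarrow> ('x \<Rightarrow> 'xi \<Rightarrow> ereal) \<Rightarrow> (nat \<Rightarrow> 'xi) \<Rightarrow> nat \<Rightarrow> 'x \<Rightarrow> real" where
  "error_tolerance \<nu> \<sigma>min \<sigma>max Q \<xi>s m x =
     \<nu> * real m powr (-1/2) * closest_point {\<sigma>min..\<sigma>max} (sample_sd Q \<xi>s m x)"

(* One realized outer iteration with scenarios \<xi>s and sample size m: the inner solver starts from
   x0 (stored as xs 0), produces points xs t with gap bounds G t for t \<ge> 1, and \<tau> is the first t
   at which the bound drops below the tolerance. Nothing is required of inner iterates after \<tau>. *)
definition saa_outer_iteration ::
  "real \<Rightarrow> real \<Rightarrow> real \<Rightarrow> real^'n \<Rightarrow> (real^'n) set \<Rightarrow> (real^'n \<Rightarrow> 'xi \<Rightarrow> ereal)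
    \<Rightarrow> (nat \<Rightarrow> 'xi) \<Rightarrow> nat \<Rightarrow> real^'n \<Rightarrow> (nat \<Rightarrow> real^'n) \<Rightarrow> (nat \<Rightarrow> real) \<Rightarrow> nat \<Rightarrow> real^'n \<Rightarrow> bool"
  where
  "saa_outer_iteration \<nu> \<sigma>min \<sigma>max c X Q \<xi>s m x0 xs G \<tau> xout \<longleftrightarrow>
     xs 0 = x0 \<and> 1 \<le> \<tau> \<and>
     (\<forall>t\<in>{1..\<tau>}. xs t \<in> X \<and>
        ereal (c \<bullet> xs t) + sample_mean Q \<xi>s m (xs t) - saa_value c X Q \<xi>s m \<le> ereal (G t)) \<and>
     (\<forall>t\<in>{1..<\<tau>}. error_tolerance \<nu> \<sigma>min \<sigma>max Q \<xi>s m (xs t) < G t) \<and>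
     G \<tau> \<le> error_tolerance \<nu> \<sigma>min \<sigma>max Q \<xi>s m (xs \<tau>) \<and>
     xout = xs \<tau>"

definition sup_sq_deviation ::
  "'x set \<Rightarrow> ('x \<Rightarrow> 'xi \<Rightarrow> ereal) \<Rightarrow> ('x \<Rightarrow> real) \<Rightarrow> (nat \<Rightarrow> 'xi) \<Rightarrow> nat \<Rightarrow> ennreal" where
  "sup_sq_deviation X Q q \<xi>s m =
     (SUP x\<in>X. e2ennreal (\<bar>sample_mean Q \<xi>s m x - ereal (q x)\<bar>\<^sup>2))"

definition cond_variance :: "'w measure \<Rightarrow> 'w measure \<Rightarrow> ('w \<Rightarrow> real) \<Rightarrow> 'w \<Rightarrow> ennreal" where
  "cond_variance M F Y = nn_cond_exp M F (\<lambda>\<omega>. ennreal ((Y \<omega> - real_cond_exp M F Y \<omega>)\<^sup>2))"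

(* Conditional variances are determined only up to null sets, which may depend on x, so a
   pointwise supremum over an uncountable X is meaningful only for a choice of versions. *)
definition sup_cond_variance_finite ::
  "'w measure \<Rightarrow> 'w measure \<Rightarrow> 'x set \<Rightarrow> ('x \<Rightarrow> 'w \<Rightarrow> real) \<Rightarrow> bool" where
  "sup_cond_variance_finite M F X Y \<longleftrightarrow>
     (\<exists>V :: 'x \<Rightarrow> 'w \<Rightarrow> ennreal.
        (\<forall>x\<in>X. V x \<in> borel_measurable F \<and> (AE \<omega> in M. V x \<omega> = cond_variance M F (Y x) \<omega>)) \<and>
        (AE \<omega> in M. (SUP x\<in>X. V x \<omega>) < \<infinity>))"

definition optimal_value :: "'x set \<Rightarrow> ('x \<Rightarrow> real) \<Rightarrow> real" where
  "optimal_value X f = (INF x\<in>X. f x)"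

definition optimal_set :: "'x set \<Rightarrow> ('x \<Rightarrow> real) \<Rightarrow> 'x set" where
  "optimal_set X f = {x\<in>X. \<forall>y\<in>X. f x \<le> f y}"

(* The supremum is taken in ereal since it is +\<infinity> when every feasible point is optimal. *)
definition growth_rate :: "('x::metric_space) set \<Rightarrow> ('x \<Rightarrow> real) \<Rightarrow> ereal" where
  "growth_rate X f =
     Sup {ereal s | s. \<forall>x\<in>X. f x - optimal_value X f \<ge> s * infdist x (optimal_set X f)}"

end

theory Submission
  imports Defs
begin

text \<open>
  Write \<open>D\<^sub>l\<close> for the squared uniform deviation between the sample mean and \<open>q\<close> in iteration \<open>l\<close>.
  A point that is \<open>\<epsilon>\<close>-optimal for the sample-path problem is \<open>(2 \<surd>D\<^sub>l + \<epsilon>)\<close>-optimal for the true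
  problem. With \<open>a\<^sub>l = m\<^sub>l powr (-1/2)\<close>, the inequality \<open>2 \<surd>D\<^sub>l \<le> D\<^sub>l / a\<^sub>l + a\<^sub>l\<close> bounds the true
  optimality gap by \<open>R\<^sub>l = D\<^sub>l / a\<^sub>l + (1 + \<nu> \<sigma>max) a\<^sub>l\<close>, whose expectation is at most a constant
  times \<open>a\<^sub>l\<close>. Since these expectations are summable, \<open>R\<^sub>l\<close> tends to zero almost surely and in
  mean, and first-order growth transfers this to the distance from the optimal set.

  The objective is bounded below on the polytope \<open>X\<close> because it is within a constant, uniformly on
  \<open>X\<close>, of a single realization of the second-stage value, which is a finite convex function there.
  Integrability of its value at the iterates requires it to be Borel on the whole space, since they
  may leave \<open>X\<close> on a null set.
\<close>

section \<open>Measurability of the second-stage value\<close>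

text \<open>Exhausting \<open>U\<close> by countably many compact sets makes the projection a
  countable union of compact images. For a general Borel set the projection is only analytic, hence
  the special shape \<open>C \<inter> U\<close>.\<close>

lemma sets_borel_fst_image_closed_Int_open:
  fixes C U :: "('a::euclidean_space \<times> 'b::euclidean_space) set"
  assumes "closed C" "open U"
  shows "fst ` (C \<inter> U) \<in> sets borel"
proof -
  obtain K where K: "\<And>n::nat. compact (K n)" "\<Union>(range K) = U"
    using open_Union_compact_subsets[OF \<open>open U\<close>] by metis
  have "fst ` (C \<inter> U) = (\<Union>n. fst ` (C \<inter> K n))"
    using K(2) by blast
  moreover have "compact (fst ` (C \<inter> K n))" for n
    using assms(1) K(1) by (intro compact_continuous_image continuous_intros closed_Int_compact)
  then have "fst ` (C \<inter> K n) \<in> sets borel" for n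
    by (intro borel_closed compact_imp_closed)
  ultimately show ?thesis
    by simp
qed

lemma continuous_on_matrix_vector_mult:
  fixes A :: "'a::topological_space \<Rightarrow> real^'n^'m" and v :: "'a \<Rightarrow> real^'n"
  assumes "continuous_on S A" "continuous_on S v"
  shows "continuous_on S (\<lambda>x. A x *v v x)"
  unfolding matrix_vector_mult_def by (intro continuous_intros assms)

text \<open>Cost, matrix and right-hand side are bundled into one Euclidean point, so that
  measurability over the abstract scenario space follows by composition with a single Borel
  function.\<close>

definition lp_value :: "(real^'n) \<times> (real^'n^'r) \<times> (real^'r) \<Rightarrow> ereal" where
  "lp_value p = (INF y\<in>{y. 0 \<le> y \<and> snd (snd p) \<le> fst (snd p) *v y}. ereal (fst p \<bullet> y))"

text \<open>The strict sublevel sets are projections of sigma-compact sets, so no LP duality is needed.\<close>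
lemma borel_measurable_lp_value:
  "(lp_value :: (real^'n) \<times> (real^'n^'r) \<times> (real^'r) \<Rightarrow> ereal) \<in> borel_measurable borel"
  (is "?f \<in> _")
proof (rule borel_measurableI_less)
  fix a :: ereal
  let ?C = "{z :: ((real^'n) \<times> (real^'n^'r) \<times> (real^'r)) \<times> (real^'n).
    0 \<le> snd z \<and> snd (snd (fst z)) \<le> fst (snd (fst z)) *v snd z}"
  let ?U = "{z :: ((real^'n) \<times> (real^'n^'r) \<times> (real^'r)) \<times> (real^'n). ereal (fst (fst z) \<bullet> snd z) < a}"
  have "closed ?C"
    unfolding less_eq_vec_def
    by (intro closed_Collect_conj closed_Collect_all closed_Collect_le continuous_intros
        continuous_on_matrix_vector_mult)
  moreover have "open ?U"
    by (intro open_Collect_less continuous_intros)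
  ultimately have "fst ` (?C \<inter> ?U) \<in> sets borel"
    by (rule sets_borel_fst_image_closed_Int_open)
  moreover have "{p \<in> space borel. ?f p < a} = fst ` (?C \<inter> ?U)"
    by (auto simp: lp_value_def INF_less_iff image_iff Bex_def split_paired_Ex)
  ultimately show "{p \<in> space borel. ?f p < a} \<in> sets borel"
    by simp
qed

lemma recourse_value_eq_lp_value:
  "recourse_value d W h T x \<zeta> = lp_value (d \<zeta>, W \<zeta>, h \<zeta> - T \<zeta> *v x)"
  by (simp add: recourse_value_def recourse_set_def lp_value_def)

text \<open>Joint measurability in \<open>(x, \<zeta>)\<close> is what makes the integral over
  \<open>\<zeta>\<close> a Borel function of \<open>x\<close>.\<close>

lemma borel_measurable_recourse_value:
  assumes [measurable]: "d \<in> borel_measurable P" "W \<in> borel_measurable P"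
    "h \<in> borel_measurable P" "T \<in> borel_measurable P"
  shows "(\<lambda>(x, \<zeta>). recourse_value d W h T x \<zeta>) \<in> borel_measurable (borel \<Otimes>\<^sub>M P)"
proof -
  have [measurable]: "(\<lambda>z. T (snd z) *v fst z) \<in> borel_measurable (borel \<Otimes>\<^sub>M P)"
    by (rule borel_measurable_continuous_Pair[where H = "(*v)"])
      (measurable, intro continuous_on_matrix_vector_mult continuous_intros)
  have "(\<lambda>z. lp_value (d (snd z), W (snd z), h (snd z) - T (snd z) *v fst z))
      \<in> borel_measurable (borel \<Otimes>\<^sub>M P)"
    by (rule measurable_compose[OF _ borel_measurable_lp_value]) measurable
  then show ?thesis
    by (simp add: recourse_value_eq_lp_value case_prod_unfold)
qed

lemma borel_measurable_expected_recourse: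
  assumes "d \<in> borel_measurable P" "W \<in> borel_measurable P"
    "h \<in> borel_measurable P" "T \<in> borel_measurable P" "prob_space P"
  shows "expected_recourse P (recourse_value d W h T) \<in> borel_measurable borel"
proof -
  interpret prob_space P by fact
  note borel_measurable_recourse_value[OF assms(1-4), measurable]
  show ?thesis
    unfolding expected_recourse_def[abs_def] by measurable
qed

section \<open>Convexity and lower boundedness on the feasible polytope\<close>

text \<open>The barycenter of the vertices is a convex combination, with weights independent of \<open>x\<close>,
  of an arbitrary point \<open>x\<close> and another point \<open>w\<close> of the polytope.\<close>
lemma convex_on_convex_hull_bdd_below:
  fixes f :: "'a::real_vector \<Rightarrow> real"
  assumes "finite S" and f: "convex_on (convex hull S) f"
  shows "bdd_below (f ` (convex hull S))"
proof (cases "S = {}")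
  case False
  define n where "n = real (card S)"
  have n: "n > 0" using \<open>finite S\<close> False by (simp add: n_def card_gt_0_iff)
  define B where "B = Max (f ` S)"
  have B: "f x \<le> B" if "x \<in> convex hull S" for x
    using convex_on_convex_hull_bound[OF f, of B] that \<open>finite S\<close> by (simp add: B_def)
  define x0 where "x0 = (\<Sum>v\<in>S. (1/n) *\<^sub>R v)"
  show ?thesis
  proof (rule bdd_belowI2)
    fix x assume x: "x \<in> convex hull S"
    then obtain u where u: "\<forall>v\<in>S. 0 \<le> u v" "sum u S = 1" "x = (\<Sum>v\<in>S. u v *\<^sub>R v)"
      using convex_hull_finite[OF \<open>finite S\<close>] by auto
    \<comment> \<open>The weights solve \<open>1/n = u v / (n+1) + (n/(n+1)) * weight\<close> for
      each vertex; \<open>u v \<le> 1\<close> keeps them nonnegative.\<close>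
    define w where "w = (\<Sum>v\<in>S. (((n + 1) / n - u v) / n) *\<^sub>R v)"
    have u_le: "u v \<le> (n + 1) / n" if "v \<in> S" for v
    proof -
      have "u v \<le> 1" using member_le_sum[of v S u] u(1,2) \<open>finite S\<close> that by auto
      also have "1 \<le> (n + 1) / n" using n by simp
      finally show ?thesis .
    qed
    have "(\<Sum>v\<in>S. ((n + 1) / n - u v) / n) = (n * ((n + 1) / n) - 1) / n"
      by (simp add: sum_divide_distrib[symmetric] sum_subtractf u n_def)
    also have "\<dots> = 1" using n by simp
    finally have "w \<in> convex hull S"
      unfolding w_def using u_le n
      by (intro convex_sum \<open>finite S\<close> convex_convex_hull) (auto intro: hull_inc)
    have "x0 = (1 / (n + 1)) *\<^sub>R x + (n / (n + 1)) *\<^sub>R w"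
    proof -
      have "1 / n = 1 / (n + 1) * u v + n / (n + 1) * (((n + 1) / n - u v) / n)" for v
        using n by (simp add: divide_simps)
      then have "x0 = (\<Sum>v\<in>S. (1 / (n + 1) * u v + n / (n + 1) * (((n + 1) / n - u v) / n)) *\<^sub>R v)"
        unfolding x0_def by metis
      then show ?thesis
        by (simp add: u(3) w_def scaleR_sum_right scaleR_add_left sum.distrib)
    qed
    moreover have "1 / (n + 1) + n / (n + 1) = 1" using n by (simp add: field_simps)
    moreover have "f (s *\<^sub>R x + t *\<^sub>R w) \<le> s * f x + t * f w"
      if "0 \<le> s" "0 \<le> t" "s + t = 1" for s t
      using f x \<open>w \<in> convex hull S\<close> that by (auto simp: convex_on_def)
    ultimately have "f x0 \<le> 1 / (n + 1) * f x + n / (n + 1) * f w"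
      using n by (metis add_pos_pos less_imp_le zero_less_divide_iff zero_less_one)
    also have "\<dots> \<le> 1 / (n + 1) * f x + n / (n + 1) * B"
      using B[OF \<open>w \<in> convex hull S\<close>] n by (intro add_mono mult_left_mono) auto
    also have "\<dots> = (f x + n * B) / (n + 1)"
      by (simp add: add_divide_distrib)
    \<comment> \<open>Only \<open>f x\<close> depends on \<open>x\<close> here, so solving for it
      gives a uniform lower bound.\<close>
    finally show "(n + 1) * f x0 - n * B \<le> f x"
      using n by (simp add: field_simps)
  qed
qed simp

text \<open>Together with compactness this presents the feasible set as the convex hull of finitely
  many points.\<close>

lemma polyhedron_first_stage_set: "polyhedron (first_stage_set A b)"
proof -
  have "first_stage_set A b =
    (\<Inter>i. {x. axis i 1 \<bullet> x \<ge> 0}) \<inter> (\<Inter>i. {x. A $ i \<bullet> x = b $ i})"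
    by (auto simp: first_stage_set_def less_eq_vec_def vec_eq_iff inner_axis' matrix_vector_mul_component)
  then show ?thesis
    by (auto intro!: polyhedron_Int polyhedron_Inter polyhedron_halfspace_ge polyhedron_hyperplane)
qed

text \<open>The second-stage constraints are jointly linear in both decisions, so mixing
  \<open>e\<close>-optimal recourse decisions for \<open>x\<close> and \<open>y\<close> gives a
  feasible one for the mixed point; then \<open>e\<close> tends to 0.\<close>

lemma convex_on_recourse_value:
  assumes "convex C" and g: "\<And>x. x \<in> C \<Longrightarrow> recourse_value d W h T x \<zeta> = ereal (g x)"
  shows "convex_on C g"
proof (rule convex_onI[OF _ \<open>convex C\<close>])
  fix t :: real and x y assume t: "0 < t" "t < 1" and xy: "x \<in> C" "y \<in> C"
  define z where "z = (1 - t) *\<^sub>R x + t *\<^sub>R y"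
  have "z \<in> C" unfolding z_def using \<open>convex C\<close> t xy by (simp add: convex_alt)
  have "g z \<le> (1 - t) * g x + t * g y + e" if "e > 0" for e
  proof -
    have "\<exists>u. 0 \<le> u \<and> h \<zeta> - T \<zeta> *v x' \<le> W \<zeta> *v u \<and> d \<zeta> \<bullet> u < g x' + e" if "x' \<in> C" for x'
    proof -
      have "recourse_value d W h T x' \<zeta> < ereal (g x' + e)" using g[OF that] \<open>e > 0\<close> by simp
      then show ?thesis by (auto simp: recourse_value_def recourse_set_def INF_less_iff)
    qed
    then obtain u v where u: "0 \<le> u" "h \<zeta> - T \<zeta> *v x \<le> W \<zeta> *v u" "d \<zeta> \<bullet> u < g x + e"
      and v: "0 \<le> v" "h \<zeta> - T \<zeta> *v y \<le> W \<zeta> *v v" "d \<zeta> \<bullet> v < g y + e"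
      using xy by metis
    let ?w = "(1 - t) *\<^sub>R u + t *\<^sub>R v"
    have "h \<zeta> - T \<zeta> *v z = (1 - t) *\<^sub>R (h \<zeta> - T \<zeta> *v x) + t *\<^sub>R (h \<zeta> - T \<zeta> *v y)"
      by (simp add: z_def matrix_vector_right_distrib matrix_vector_mult_scaleR algebra_simps)
    also have "\<dots> \<le> (1 - t) *\<^sub>R (W \<zeta> *v u) + t *\<^sub>R (W \<zeta> *v v)"
      using u(2) v(2) t by (intro add_mono scaleR_left_mono) auto
    also have "\<dots> = W \<zeta> *v ?w"
      by (simp add: matrix_vector_right_distrib matrix_vector_mult_scaleR)
    finally have "?w \<in> recourse_set W h T z \<zeta>"
      using u(1) v(1) t by (simp add: recourse_set_def scaleR_nonneg_nonneg)
    then have "recourse_value d W h T z \<zeta> \<le> ereal (d \<zeta> \<bullet> ?w)"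
      unfolding recourse_value_def by (rule INF_lower)
    then have "g z \<le> (1 - t) * (d \<zeta> \<bullet> u) + t * (d \<zeta> \<bullet> v)"
      using g[OF \<open>z \<in> C\<close>] by (simp add: inner_add_right)
    also have "\<dots> \<le> (1 - t) * (g x + e) + t * (g y + e)"
      using u(3) v(3) t by (intro add_mono mult_left_mono) auto
    also have "\<dots> = (1 - t) * g x + t * g y + e" by (simp add: algebra_simps)
    finally show ?thesis .
  qed
  then show "g ((1 - t) *\<^sub>R x + t *\<^sub>R y) \<le> (1 - t) * g x + t * g y"
    unfolding z_def by (rule field_le_epsilon)
qed

section \<open>From sample-path optimality to true optimality\<close>

lemma sample_mean_deviation:
  assumes "sup_sq_deviation X Q q s n < \<infinity>" "x \<in> X"
  obtains r where "sample_mean Q s n x = ereal r"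
    "\<bar>r - q x\<bar> \<le> sqrt (enn2real (sup_sq_deviation X Q q s n))"
proof -
  let ?D = "sup_sq_deviation X Q q s n"
  have *: "e2ennreal (\<bar>sample_mean Q s n x - ereal (q x)\<bar>\<^sup>2) \<le> ?D"
    unfolding sup_sq_deviation_def by (rule SUP_upper[OF \<open>x \<in> X\<close>])
  have fin: "e2ennreal (\<bar>sample_mean Q s n x - ereal (q x)\<bar>\<^sup>2) \<noteq> \<infinity>"
    using * assms(1) by (auto simp: top_unique)
  show ?thesis
  \<comment> \<open>An infinite sample mean would have infinite squared deviation, so finiteness of
    the supremum leaves only the real case.\<close>
  proof (cases "sample_mean Q s n x")
    case (real r)
    have "ennreal ((r - q x)\<^sup>2) \<le> ?D"
      using * by (simp add: real power2_eq_square abs_mult[symmetric] flip: ennreal.rep_eq)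
    then have "(r - q x)\<^sup>2 \<le> enn2real ?D"
      using assms(1) by (metis enn2real_ennreal enn2real_mono infinity_ennreal_def zero_le_power2)
    then have "\<bar>r - q x\<bar> \<le> sqrt (enn2real ?D)"
      by (metis real_sqrt_abs real_sqrt_le_iff)
    with real show ?thesis by (rule that)
  qed (use fin in \<open>simp_all add: power2_eq_square e2ennreal_infty\<close>)
qed

text \<open>Exchanging \<open>q\<close> for the sample mean costs one uniform deviation at
  \<open>xout\<close> and one at the competitor \<open>y\<close>, whence the factor 2; the stopping
  rule accounts for the last term.\<close>

lemma saa_outer_iteration_near_optimal:
  assumes run: "saa_outer_iteration \<nu> \<sigma>min \<sigma>max c X Q s n x0 xs G \<tau> xout"
    and const: "\<nu> > 0" "\<sigma>min < \<sigma>max"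
    and fin: "sup_sq_deviation X Q q s n < \<infinity>" and y: "y \<in> X"
  shows "c \<bullet> xout + q xout \<le> c \<bullet> y + q y
    + (2 * sqrt (enn2real (sup_sq_deviation X Q q s n)) + \<nu> * \<sigma>max * real n powr (-1/2))"
proof -
  let ?\<delta> = "sqrt (enn2real (sup_sq_deviation X Q q s n))"
  let ?tol = "error_tolerance \<nu> \<sigma>min \<sigma>max Q s n xout"
  have "1 \<le> \<tau>" "xout = xs \<tau>" "G \<tau> \<le> ?tol"
    and "\<And>t. t \<in> {1..\<tau>} \<Longrightarrow> xs t \<in> X \<and>
      ereal (c \<bullet> xs t) + sample_mean Q s n (xs t) - saa_value c X Q s n \<le> ereal (G t)"
    using run by (simp_all add: saa_outer_iteration_def)
  from this(1-3) this(4)[of \<tau>] have xout: "xout \<in> X"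
    and gap: "ereal (c \<bullet> xout) + sample_mean Q s n xout - saa_value c X Q s n \<le> ereal ?tol"
    by (auto intro: order_trans)
  \<comment> \<open>The projection caps the random standard deviation at \<open>\<sigma>max\<close>,
    so the tolerance has a deterministic bound.\<close>
  have "closest_point {\<sigma>min..\<sigma>max} (sample_sd Q s n xout) \<in> {\<sigma>min..\<sigma>max}"
    using const by (intro closest_point_in_set) auto
  then have "\<nu> * real n powr (-1/2) * closest_point {\<sigma>min..\<sigma>max} (sample_sd Q s n xout)
      \<le> \<nu> * real n powr (-1/2) * \<sigma>max"
    using const by (intro mult_left_mono) auto
  then have tol: "?tol \<le> \<nu> * \<sigma>max * real n powr (-1/2)"
    by (simp add: error_tolerance_def mult_ac)
  obtain r where r: "sample_mean Q s n xout = ereal r" "\<bar>r - q xout\<bar> \<le> ?\<delta>"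
    by (rule sample_mean_deviation[OF fin xout])
  obtain r' where r': "sample_mean Q s n y = ereal r'" "\<bar>r' - q y\<bar> \<le> ?\<delta>"
    by (rule sample_mean_deviation[OF fin y])
  have "saa_value c X Q s n \<le> ereal (c \<bullet> y + r')"
    using INF_lower[OF y, of "\<lambda>x. ereal (c \<bullet> x) + sample_mean Q s n x"]
    by (simp add: saa_value_def r'(1))
  \<comment> \<open>The value \<open>\<infinity>\<close> for \<open>saa_value\<close> contradicts
    the bound through \<open>y\<close>, and \<open>-\<infinity>\<close> would make the gap
    infinite.\<close>
  with gap have "c \<bullet> xout + r \<le> c \<bullet> y + r' + ?tol"
    by (cases "saa_value c X Q s n") (simp_all add: r(1))
  with r(2) r'(2) tol show ?thesis by linarith
qed

section \<open>Convergence under a majorant with summable expectations\<close>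

text \<open>By monotone convergence the pointwise series has finite expectation, so it converges
  almost surely and its terms vanish in the limit.\<close>

lemma AE_tendsto_zero_of_summable_integral:
  fixes R :: "nat \<Rightarrow> 'a \<Rightarrow> real"
  assumes int: "\<And>n. integrable M (R n)" and nonneg: "\<And>n. AE x in M. 0 \<le> R n x"
    and "summable (\<lambda>n. \<integral>x. R n x \<partial>M)"
  shows "AE x in M. (\<lambda>n. R n x) \<longlonglongrightarrow> 0"
proof -
  note [measurable] = borel_measurable_integrable[OF int]
  have "(\<integral>\<^sup>+x. (\<Sum>n. ennreal (R n x)) \<partial>M) = (\<Sum>n. \<integral>\<^sup>+x. ennreal (R n x) \<partial>M)"
    by (rule nn_integral_suminf) simp
  also have "\<dots> = (\<Sum>n. ennreal (\<integral>x. R n x \<partial>M))"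
    by (simp add: nn_integral_eq_integral int nonneg)
  also have "\<dots> \<noteq> \<infinity>"
    using assms(3) integral_nonneg_AE[OF nonneg] by (simp add: suminf_ennreal2)
  finally have "AE x in M. (\<Sum>n. ennreal (R n x)) \<noteq> \<infinity>"
    by (intro nn_integral_PInf_AE) simp_all
  moreover have "AE x in M. \<forall>n. 0 \<le> R n x"
    using nonneg by (simp add: AE_all_countable)
  ultimately show ?thesis
    by eventually_elim (auto intro!: summable_LIMSEQ_zero summable_suminf_not_top)
qed

text \<open>A sandwich argument, pointwise and for integrals, serving both the objective values
  (\<open>v\<close> the optimal value) and the distances (\<open>v = 0\<close>).\<close>

lemma (in prob_space) tendsto_AE_and_expectation_of_summable_majorant:
  fixes Z R :: "nat \<Rightarrow> 'a \<Rightarrow> real"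
  assumes Z: "\<And>n. Z n \<in> borel_measurable M"
    and bounds: "\<And>n. AE x in M. v \<le> Z n x \<and> Z n x \<le> v + R n x"
    and R: "\<And>n. integrable M (R n)" "summable (\<lambda>n. \<integral>x. R n x \<partial>M)"
  shows "AE x in M. (\<lambda>n. Z n x) \<longlonglongrightarrow> v"
    and "\<And>n. integrable M (Z n)"
    and "(\<lambda>n. \<integral>x. Z n x \<partial>M) \<longlonglongrightarrow> v"
proof -
  have "AE x in M. 0 \<le> R n x" for n
    using bounds[of n] by eventually_elim linarith
  then have "AE x in M. (\<lambda>n. R n x) \<longlonglongrightarrow> 0"
    by (intro AE_tendsto_zero_of_summable_integral R)
  moreover have "AE x in M. \<forall>n. v \<le> Z n x \<and> Z n x \<le> v + R n x"
    using bounds by (simp add: AE_all_countable)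
  ultimately show "AE x in M. (\<lambda>n. Z n x) \<longlonglongrightarrow> v"
  proof eventually_elim
    case (elim x)
    show ?case
      by (rule real_tendsto_sandwich[where f = "\<lambda>_. v" and h = "\<lambda>n. v + R n x"])
        (use elim tendsto_add[OF tendsto_const[of v] elim(1)] in auto)
  qed
  show int: "integrable M (Z n)" for n
  proof (rule Bochner_Integration.integrable_bound[where f = "\<lambda>x. \<bar>v\<bar> + R n x"])
    show "AE x in M. norm (Z n x) \<le> norm (\<bar>v\<bar> + R n x)"
      using bounds[of n] by eventually_elim auto
  qed (use R(1) Z in auto)
  have lower: "v \<le> (\<integral>x. Z n x \<partial>M)" for n
    using integral_mono_AE[of M "\<lambda>_. v" "Z n"] int bounds[of n] by (auto simp: prob_space)
  have upper: "(\<integral>x. Z n x \<partial>M) \<le> v + (\<integral>x. R n x \<partial>M)" for n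
    using integral_mono_AE[of M "Z n" "\<lambda>x. v + R n x"] int R(1) bounds[of n]
    by (auto simp: prob_space)
  show "(\<lambda>n. \<integral>x. Z n x \<partial>M) \<longlonglongrightarrow> v"
    by (rule real_tendsto_sandwich[where f = "\<lambda>_. v" and h = "\<lambda>n. v + (\<integral>x. R n x \<partial>M)"])
      (use lower upper tendsto_add[OF tendsto_const[of v] summable_LIMSEQ_zero[OF R(2)]] in auto)
qed

text \<open>The tower property, obtained with constant weight 1, turns the conditional deviation
  bound into an unconditional second-moment bound.\<close>

lemma (in prob_space) nn_integral_le_of_nn_cond_exp_le:
  assumes "subalgebra M F" and [measurable]: "g \<in> borel_measurable M"
    and "AE x in M. nn_cond_exp M F g x \<le> C"
  shows "(\<integral>\<^sup>+x. g x \<partial>M) \<le> C"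
proof -
  interpret finite_measure_subalgebra M F by unfold_locales fact
  have "(\<integral>\<^sup>+x. g x \<partial>M) = (\<integral>\<^sup>+x. nn_cond_exp M F g x \<partial>M)"
    using nn_cond_exp_intg[of "\<lambda>_. 1" g] by simp
  also have "\<dots> \<le> (\<integral>\<^sup>+x. C \<partial>M)"
    by (rule nn_integral_mono_AE) fact
  finally show ?thesis by (simp add: emeasure_space_1)
qed

text \<open>Weighted AM-GM: the square root is traded for a term linear in \<open>e\<close>, whose
  expectation a second-moment bound controls directly.\<close>

lemma two_sqrt_le_weighted:
  fixes a e :: real
  assumes "0 < a" "0 \<le> e"
  shows "2 * sqrt e \<le> e / a + a"
proof -
  have "0 \<le> (sqrt e - a)\<^sup>2" by simp
  then have "2 * sqrt e * a \<le> e + a * a"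
    using assms(2) by (simp add: power2_diff power2_eq_square algebra_simps)
  with assms(1) show ?thesis by (simp add: field_simps)
qed

section \<open>Almost sure and mean convergence of objective values and distances\<close>

theorem theorem4p2:
  fixes A :: "real^'n1^'k" and b :: "real^'k" and c :: "real^'n1"
    and P :: "'xi measure"
    and d :: "'xi \<Rightarrow> real^'n2" and W :: "'xi \<Rightarrow> real^'n2^'r"
    and h :: "'xi \<Rightarrow> real^'r" and T :: "'xi \<Rightarrow> real^'n1^'r"
    and X :: "(real^'n1) set" and Q :: "real^'n1 \<Rightarrow> 'xi \<Rightarrow> ereal"
    and q f :: "real^'n1 \<Rightarrow> real"
    and M :: "'w measure" and F :: "nat \<Rightarrow> 'w measure"
    and \<xi> :: "nat \<Rightarrow> nat \<Rightarrow> 'w \<Rightarrow> 'xi" and m :: "nat \<Rightarrow> nat"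
    and \<nu> \<sigma>min \<sigma>max \<kappa>\<^sub>0 :: real
    and xhat :: "nat \<Rightarrow> 'w \<Rightarrow> real^'n1"
    and xs :: "nat \<Rightarrow> nat \<Rightarrow> 'w \<Rightarrow> real^'n1" and G :: "nat \<Rightarrow> nat \<Rightarrow> 'w \<Rightarrow> real"
    and \<tau> :: "nat \<Rightarrow> 'w \<Rightarrow> nat"
  assumes X_eq: "X = first_stage_set A b"
    and Q_eq: "Q = recourse_value d W h T"
    and q_eq: "q = expected_recourse P Q"
    and f_eq: "f = (\<lambda>x. c \<bullet> x + q x)"
    and prob_P: "prob_space P"
    and data_measurable: "d \<in> borel_measurable P" "W \<in> borel_measurable P"
      "h \<in> borel_measurable P" "T \<in> borel_measurable P"
    and bounded_recourse: "\<And>x \<zeta>. x \<in> X \<Longrightarrow> \<zeta> \<in> space P \<Longrightarrow> Q x \<zeta> > -\<infinity>"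
    and prob_M: "prob_space M"
    and filtration: "filtration (space M) F"
    and subalgebra: "\<And>l. subalgebra M (F l)"
    and scenario_measurable: "\<And>l j. 1 \<le> l \<Longrightarrow> 1 \<le> j \<Longrightarrow> \<xi> l j \<in> F l \<rightarrow>\<^sub>M P"
    and scenario_law: "\<And>l j. 1 \<le> l \<Longrightarrow> 1 \<le> j \<Longrightarrow> distr M P (\<xi> l j) = P"
    and constants: "\<nu> > 0" "0 < \<sigma>min" "\<sigma>min < \<sigma>max"
    and xhat_measurable: "\<And>l. 1 \<le> l \<Longrightarrow> xhat l \<in> borel_measurable (F l)"
    and algorithm: "AE \<omega> in M. \<forall>l\<ge>1.
      saa_outer_iteration \<nu> \<sigma>min \<sigma>max c X Q (\<lambda>j. \<xi> l j \<omega>) (m l) (xhat (l - 1) \<omega>)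
        (\<lambda>t. xs l t \<omega>) (\<lambda>t. G l t \<omega>) (\<tau> l \<omega>) (xhat l \<omega>)"
    and compact_X: "compact X"
    and complete_recourse: "\<And>x. x \<in> X \<Longrightarrow> AE \<zeta> in P. recourse_set W h T x \<zeta> \<noteq> {}"
    and cond_var: "\<And>l j. 1 \<le> l \<Longrightarrow> 1 \<le> j \<Longrightarrow>
      sup_cond_variance_finite M (F (l - 1)) X (\<lambda>x \<omega>. real_of_ereal (Q x (\<xi> l j \<omega>)))"
    and deviation_measurable: "\<And>l n. 1 \<le> l \<Longrightarrow> 1 \<le> n \<Longrightarrow>
      (\<lambda>\<omega>. sup_sq_deviation X Q q (\<lambda>j. \<xi> l j \<omega>) n) \<in> borel_measurable M"
    and deviation_bound: "\<And>l n. 1 \<le> l \<Longrightarrow> 1 \<le> n \<Longrightarrow>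
      AE \<omega> in M. nn_cond_exp M (F (l - 1))
        (\<lambda>\<omega>. sup_sq_deviation X Q q (\<lambda>j. \<xi> l j \<omega>) n) \<omega> \<le> ennreal (\<kappa>\<^sub>0 / real n)"
    and sample_size_pos: "\<And>l. 1 \<le> l \<Longrightarrow> 1 \<le> m l"
    and sample_size_summable: "summable (\<lambda>l. real (m (Suc l)) powr (-1/2))"
  shows "(AE \<omega> in M. (\<lambda>l. f (xhat l \<omega>)) \<longlonglongrightarrow> optimal_value X f) \<and>
    ((\<forall>l\<ge>1. integrable M (\<lambda>\<omega>. f (xhat l \<omega>))) \<and>
      (\<lambda>l. \<integral>\<omega>. f (xhat l \<omega>) \<partial>M) \<longlonglongrightarrow> optimal_value X f) \<and>
    (growth_rate X f > 0 \<longrightarrow>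
      (AE \<omega> in M. (\<lambda>l. infdist (xhat l \<omega>) (optimal_set X f)) \<longlonglongrightarrow> 0) \<and>
      ((\<forall>l\<ge>1. integrable M (\<lambda>\<omega>. infdist (xhat l \<omega>) (optimal_set X f))) \<and>
        (\<lambda>l. \<integral>\<omega>. infdist (xhat l \<omega>) (optimal_set X f) \<partial>M) \<longlonglongrightarrow> 0))"
proof -
  interpret prob_space M by fact
  define D where "D = (\<lambda>l n \<omega>. sup_sq_deviation X Q q (\<lambda>j. \<xi> l j \<omega>) n)"
  have D[measurable]: "D l n \<in> borel_measurable M" if "1 \<le> l" "1 \<le> n" for l n
    using deviation_measurable[OF that] by (simp add: D_def)
  have int_D: "(\<integral>\<^sup>+\<omega>. D l n \<omega> \<partial>M) \<le> ennreal (\<kappa>\<^sub>0 / real n)" if "1 \<le> l" "1 \<le> n" for l n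
    using nn_integral_le_of_nn_cond_exp_le[OF subalgebra D[OF that]] deviation_bound[OF that]
    by (simp add: D_def)
  have D_fin: "AE \<omega> in M. D l n \<omega> < \<infinity>" if "1 \<le> l" "1 \<le> n" for l n
    using nn_integral_PInf_AE[OF D[OF that]] le_less_trans[OF int_D[OF that] ennreal_less_top]
    by (simp add: less_top)

  have "q \<in> borel_measurable borel"
    unfolding q_eq Q_eq by (rule borel_measurable_expected_recourse) fact+
  then have f_meas: "f \<in> borel_measurable borel"
    unfolding f_eq by measurable
  have xhat_meas[measurable]: "xhat l \<in> borel_measurable M" if "1 \<le> l" for l
    using xhat_measurable[OF that] subalgebra by (rule measurable_from_subalg[rotated])

  \<comment> \<open>For sample size 1 the sample mean is a single second-stage value. One
    realization with finite deviation thus gives a scenario \<open>\<zeta>\<close> whose value is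
    finite and within \<open>\<delta>\<close> of \<open>q\<close> throughout
    \<open>X\<close>.\<close>
  obtain \<omega>\<^sub>0 where "D 1 1 \<omega>\<^sub>0 < \<infinity>"
    using AE_contr[of "\<lambda>\<omega>. D 1 1 \<omega> < \<infinity>"] D_fin[of 1 1] by auto
  define \<zeta> where "\<zeta> = \<xi> 1 1 \<omega>\<^sub>0"
  define \<delta> where "\<delta> = sqrt (enn2real (D 1 1 \<omega>\<^sub>0))"
  define g where "g x = real_of_ereal (Q x \<zeta>)" for x
  have g: "Q x \<zeta> = ereal (g x) \<and> \<bar>g x - q x\<bar> \<le> \<delta>" if "x \<in> X" for x
    using sample_mean_deviation[OF _ that] \<open>D 1 1 \<omega>\<^sub>0 < \<infinity>\<close>
    unfolding D_def \<delta>_def g_def \<zeta>_def sample_mean_def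
    by (fastforce simp: one_ereal_def[symmetric])
  obtain S where S: "finite S" "X = convex hull S"
    using polyhedron_first_stage_set[of A b] compact_X X_eq
    by (metis compact_imp_bounded polytope_def polytope_eq_bounded_polyhedron)
  have "convex_on X g"
    using g Q_eq S(2) by (intro convex_on_recourse_value) auto
  then have "bdd_below (g ` X)"
    using convex_on_convex_hull_bdd_below S by metis
  then obtain g0 where g0: "\<And>x. x \<in> X \<Longrightarrow> g0 \<le> g x"
    by (auto simp: bdd_below_def)
  obtain B where B: "\<And>x. x \<in> X \<Longrightarrow> norm x \<le> B"
    using compact_imp_bounded[OF compact_X] by (auto simp: bounded_iff)
  \<comment> \<open>The real-valued infimum in \<open>optimal_value\<close> is a genuine lower bound
    only for a function bounded below. The bound combines \<open>g0\<close>, the distance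
    \<open>\<delta>\<close> and Cauchy-Schwarz for the linear cost.\<close>
  have f_bdd: "bdd_below (f ` X)"
  proof (rule bdd_belowI2)
    fix x assume x: "x \<in> X"
    have "\<bar>c \<bullet> x\<bar> \<le> norm c * norm x" by (rule Cauchy_Schwarz_ineq2)
    also have "\<dots> \<le> norm c * B" by (intro mult_left_mono B x) simp
    finally show "g0 - \<delta> - norm c * B \<le> f x"
      using g[OF x] g0[OF x] by (auto simp: f_eq)
  qed

  let ?v = "optimal_value X f"
  \<comment> \<open>Iterations start at 1, so index \<open>l\<close> of \<open>a\<close>,
    \<open>E\<close> and \<open>R\<close> refers to iteration \<open>Suc l\<close>.\<close>
  define a where "a l = real (m (Suc l)) powr (-1/2)" for l
  define E where "E l \<omega> = enn2real (D (Suc l) (m (Suc l)) \<omega>)" for l \<omega>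
  define K where "K = \<nu> * \<sigma>max"
  define R where "R l \<omega> = E l \<omega> / a l + (1 + K) * a l" for l \<omega>
  have a_pos: "0 < a l" for l
    using sample_size_pos[of "Suc l"] by (simp add: a_def)
  \<comment> \<open>Since \<open>1/m\<close> is the square of \<open>a l\<close>, dividing a mean of
    order \<open>1/m\<close> by \<open>a l\<close> leaves order \<open>a l\<close>, the summable
    rate.\<close>
  have a_sq: "1 / real (m (Suc l)) = a l * a l" for l
    using sample_size_pos[of "Suc l"]
    by (simp add: a_def powr_add[symmetric] powr_minus_divide)
  have a_summable: "summable a"
    using sample_size_summable by (simp add: a_def[abs_def])

  have xhat_bounds: "AE \<omega> in M. xhat (Suc l) \<omega> \<in> X \<and>
      ?v \<le> f (xhat (Suc l) \<omega>) \<and> f (xhat (Suc l) \<omega>) \<le> ?v + R l \<omega>" for l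
    using algorithm D_fin[OF _ sample_size_pos[of "Suc l"], of "Suc l", simplified]
  proof eventually_elim
    case (elim \<omega>)
    let ?x = "xhat (Suc l) \<omega>"
    have run: "saa_outer_iteration \<nu> \<sigma>min \<sigma>max c X Q (\<lambda>j. \<xi> (Suc l) j \<omega>) (m (Suc l)) (xhat l \<omega>)
        (\<lambda>t. xs (Suc l) t \<omega>) (\<lambda>t. G (Suc l) t \<omega>) (\<tau> (Suc l) \<omega>) ?x"
      using elim(1)[rule_format, of "Suc l"] by simp
    then have x: "?x \<in> X" by (auto simp: saa_outer_iteration_def)
    have "f ?x \<le> f y + (2 * sqrt (E l \<omega>) + K * a l)" if "y \<in> X" for y
      using saa_outer_iteration_near_optimal[OF run constants(1,3) _ that] elim(2)
      by (simp add: f_eq D_def E_def K_def a_def)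
    \<comment> \<open>Taking the infimum over \<open>y\<close> requires \<open>X\<close> to be
      nonempty; the iterate \<open>?x\<close> itself witnesses this.\<close>
    then have "f ?x - (2 * sqrt (E l \<omega>) + K * a l) \<le> ?v"
      unfolding optimal_value_def using x by (intro cINF_greatest) (auto simp: algebra_simps)
    moreover have "2 * sqrt (E l \<omega>) \<le> E l \<omega> / a l + a l"
      by (rule two_sqrt_le_weighted[OF a_pos]) (simp add: E_def)
    moreover have "?v \<le> f ?x"
      unfolding optimal_value_def by (rule cINF_lower[OF f_bdd x])
    ultimately show ?case using x by (simp add: R_def algebra_simps)
  qed

  have R_int: "integrable M (R l)" and R_le: "(\<integral>\<omega>. R l \<omega> \<partial>M) \<le> (\<bar>\<kappa>\<^sub>0\<bar> + 1 + K) * a l" for l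
  proof -
    let ?n = "m (Suc l)"
    have n: "1 \<le> ?n" using sample_size_pos by simp
    \<comment> \<open>\<open>enn2real\<close> maps infinity to 0, so the equality rests on the
      almost sure finiteness of \<open>D\<close>.\<close>
    have D_fin': "AE \<omega> in M. ennreal (E l \<omega>) = D (Suc l) ?n \<omega>"
      using D_fin[OF _ n, of "Suc l", simplified] by eventually_elim (simp add: E_def)
    then have "(\<integral>\<^sup>+\<omega>. ennreal (E l \<omega>) \<partial>M) = (\<integral>\<^sup>+\<omega>. D (Suc l) ?n \<omega> \<partial>M)"
      by (rule nn_integral_cong_AE)
    also have "\<dots> \<le> ennreal (\<kappa>\<^sub>0 / real ?n)" using int_D[OF _ n] by simp
    \<comment> \<open>The sign of \<open>\<kappa>\<^sub>0\<close> is unrestricted and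
      \<open>ennreal\<close> clamps negative numbers to 0; the absolute value gives a bound in both
      cases.\<close>
    also have "\<dots> \<le> ennreal (\<bar>\<kappa>\<^sub>0\<bar> * (a l * a l))"
      unfolding a_sq[symmetric] by (intro ennreal_leI) (simp add: divide_right_mono)
    finally have E_le: "(\<integral>\<^sup>+\<omega>. ennreal (E l \<omega>) \<partial>M) \<le> ennreal (\<bar>\<kappa>\<^sub>0\<bar> * (a l * a l))" .
    have E_meas: "E l \<in> borel_measurable M"
      unfolding E_def[abs_def] using D[OF _ n, of "Suc l"] by simp
    have E_nonneg: "0 \<le> E l \<omega>" for \<omega> by (simp add: E_def)
    have E_int: "integrable M (E l)"
      using le_less_trans[OF E_le ennreal_less_top]
      by (intro integrableI_nonneg E_meas) (simp_all add: E_nonneg)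
    then show "integrable M (R l)" by (simp add: R_def[abs_def])
    have "(\<integral>\<omega>. E l \<omega> \<partial>M) \<le> \<bar>\<kappa>\<^sub>0\<bar> * (a l * a l)"
      using E_le nn_integral_eq_integral[OF E_int] E_nonneg by simp
    then have "(\<integral>\<omega>. E l \<omega> \<partial>M) / a l \<le> \<bar>\<kappa>\<^sub>0\<bar> * (a l * a l) / a l"
      using a_pos[of l] by (intro divide_right_mono) auto
    then have "(\<integral>\<omega>. E l \<omega> \<partial>M) / a l \<le> \<bar>\<kappa>\<^sub>0\<bar> * a l"
      using a_pos[of l] by simp
    then show "(\<integral>\<omega>. R l \<omega> \<partial>M) \<le> (\<bar>\<kappa>\<^sub>0\<bar> + 1 + K) * a l"
      using E_int by (simp add: R_def[abs_def] prob_space algebra_simps)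
  qed
  have R_nonneg: "0 \<le> (\<integral>\<omega>. R l \<omega> \<partial>M)" for l
  proof (rule integral_nonneg_AE)
    show "AE \<omega> in M. 0 \<le> R l \<omega>"
      using xhat_bounds[of l] by eventually_elim linarith
  qed
  have R_summable: "summable (\<lambda>l. \<integral>\<omega>. R l \<omega> \<partial>M)"
    by (rule summable_comparison_test'[OF summable_mult[OF a_summable]])
      (use R_le R_nonneg in auto)

  have objective: "AE \<omega> in M. (\<lambda>l. f (xhat (Suc l) \<omega>)) \<longlonglongrightarrow> ?v"
    "\<And>l. integrable M (\<lambda>\<omega>. f (xhat (Suc l) \<omega>))"
    "(\<lambda>l. \<integral>\<omega>. f (xhat (Suc l) \<omega>) \<partial>M) \<longlonglongrightarrow> ?v"
  proof -
    note * = tendsto_AE_and_expectation_of_summable_majorant[OF _ _ R_int R_summable,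
        where v = ?v and Z = "\<lambda>l \<omega>. f (xhat (Suc l) \<omega>)"]
    have Z: "(\<lambda>\<omega>. f (xhat (Suc l) \<omega>)) \<in> borel_measurable M" for l
      using measurable_compose[OF xhat_meas f_meas] by simp
    have b: "AE \<omega> in M. ?v \<le> f (xhat (Suc l) \<omega>) \<and> f (xhat (Suc l) \<omega>) \<le> ?v + R l \<omega>" for l
      using xhat_bounds[of l] by eventually_elim simp
    show "AE \<omega> in M. (\<lambda>l. f (xhat (Suc l) \<omega>)) \<longlonglongrightarrow> ?v"
      "\<And>l. integrable M (\<lambda>\<omega>. f (xhat (Suc l) \<omega>))"
      "(\<lambda>l. \<integral>\<omega>. f (xhat (Suc l) \<omega>) \<partial>M) \<longlonglongrightarrow> ?v"
      using *[OF Z b] by auto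
  qed

  have distance: "AE \<omega> in M. (\<lambda>l. infdist (xhat (Suc l) \<omega>) (optimal_set X f)) \<longlonglongrightarrow> 0"
    "\<And>l. integrable M (\<lambda>\<omega>. infdist (xhat (Suc l) \<omega>) (optimal_set X f))"
    "(\<lambda>l. \<integral>\<omega>. infdist (xhat (Suc l) \<omega>) (optimal_set X f) \<partial>M) \<longlonglongrightarrow> 0"
    if growth: "growth_rate X f > 0"
  proof -
    \<comment> \<open>The supremum \<open>growth_rate\<close> may be infinite, so some positive real
      member of the underlying set serves as the rate; the majorant becomes
      \<open>R l \<omega> / s\<close>.\<close>
    obtain s where s: "0 < s" "\<And>x. x \<in> X \<Longrightarrow> s * infdist x (optimal_set X f) \<le> f x - ?v"
    proof -
      let ?S = "{ereal s | s. \<forall>x\<in>X. f x - ?v \<ge> s * infdist x (optimal_set X f)}"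
      have "\<exists>e\<in>?S. 0 < e"
        using growth unfolding growth_rate_def less_Sup_iff .
      then obtain s where "0 < ereal s" "\<forall>x\<in>X. f x - ?v \<ge> s * infdist x (optimal_set X f)"
        by blast
      then show ?thesis by (intro that[of s]) auto
    qed
    have Rs: "integrable M (\<lambda>\<omega>. R l \<omega> / s)" "summable (\<lambda>l. \<integral>\<omega>. R l \<omega> / s \<partial>M)" for l
      using R_int[of l] R_summable by (simp_all add: summable_divide)
    note * = tendsto_AE_and_expectation_of_summable_majorant[OF _ _ Rs,
        where v = 0 and Z = "\<lambda>l \<omega>. infdist (xhat (Suc l) \<omega>) (optimal_set X f)"]
    have Z: "(\<lambda>\<omega>. infdist (xhat (Suc l) \<omega>) (optimal_set X f)) \<in> borel_measurable M" for l
      using xhat_meas[of "Suc l"]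
      by (intro borel_measurable_continuous_on[OF continuous_on_infdist]) auto
    have b: "AE \<omega> in M. 0 \<le> infdist (xhat (Suc l) \<omega>) (optimal_set X f) \<and>
        infdist (xhat (Suc l) \<omega>) (optimal_set X f) \<le> 0 + R l \<omega> / s" for l
      using xhat_bounds[of l]
    proof eventually_elim
      case (elim \<omega>)
      then have "s * infdist (xhat (Suc l) \<omega>) (optimal_set X f) \<le> R l \<omega>"
        using s(2)[of "xhat (Suc l) \<omega>"] by linarith
      then show ?case using s(1) by (simp add: infdist_nonneg field_simps)
    qed
    show "AE \<omega> in M. (\<lambda>l. infdist (xhat (Suc l) \<omega>) (optimal_set X f)) \<longlonglongrightarrow> 0"
      "\<And>l. integrable M (\<lambda>\<omega>. infdist (xhat (Suc l) \<omega>) (optimal_set X f))"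
      "(\<lambda>l. \<integral>\<omega>. infdist (xhat (Suc l) \<omega>) (optimal_set X f) \<partial>M) \<longlonglongrightarrow> 0"
      using *[OF Z b] by auto
  qed

  \<comment> \<open>The hypotheses start at iteration 1: integrability is reindexed by
    \<open>Suc\<close>, and each of the four limits is unchanged by dropping its term at 0.\<close>
  have shift: "(\<forall>l\<ge>1. \<Phi> l) \<longleftrightarrow> (\<forall>l. \<Phi> (Suc l))" for \<Phi> :: "nat \<Rightarrow> bool"
    by (metis One_nat_def Suc_le_D Suc_le_mono le0)
  note shift_lim = filterlim_sequentially_Suc[symmetric]
  show ?thesis
    unfolding shift
    by (subst (1 2 3 4) shift_lim) (use objective distance in simp)
qed

end
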